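(* Let $\mathcal{H}$ be a complex Hilbert space of dimension $d\ge 1$ with orthonormal bases $\mathcal{A}=\{|a_i\rangle\}_{i=0}^{d-1}$ and $\mathcal{B}=\{|b_j\rangle\}_{j=0}^{d-1}$ whose transition matrix is the discrete Fourier transform matrix, i.e. $\langle a_i|b_j\rangle=\frac{1}{\sqrt d}\,\omega_d^{ij}$ for all $i,j\in\{0,\dots,d-1\}$, where $\omega_d=e^{2\pi\sqrt{-1}/d}$. Let $n_{\mathcal{A}},n_{\mathcal{B}}\in\{1,\dots,d\}$. If $n_{\mathcal{A}}+n_{\mathcal{B}}\ge d+1$, then $(n_{\mathcal{A}},n_{\mathcal{B}})\in \mathrm{UNCD}(\mathcal{A},\mathcal{B})$.
   Context: A state is a unit vector $|\psi\rangle\in\mathcal{H}$. Its support sizes are $n_{\mathcal{A}}(\psi)=|\{i:\langle a_i|\psi\rangle\neq 0\}|$ and $n_{\mathcal{B}}(\psi)=|\{j:\langle b_j|\psi\rangle\neq 0\}|$. The uncertainty diagram $\mathrm{UNCD}(\mathcal{A},\mathcal{B})$ is the set of pairs $(n_{\mathcal{A}},n_{\mathcal{B}})\in\{1,\dots,d\}\times\{1,\dots,d\}$ for which there exists a state $|\psi\rangle$ with $n_{\mathcal{A}}(\psi)=n_{\mathcal{A}}$ and $n_{\mathcal{B}}(\psi)=n_{\mathcal{B}}$. *)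

theory Defs
  imports Complex_Main
begin

text \<open>Inner products are conjugate-linear in the first and linear in the second argument, so that
  \<open>cinner x y\<close> is the bracket \<open>\<langle>x|y\<rangle>\<close>.\<close>

locale complex_inner_product_space = vector_space scale
  for scale :: "complex \<Rightarrow> 'h::ab_group_add \<Rightarrow> 'h" +
  fixes cinner :: "'h \<Rightarrow> 'h \<Rightarrow> complex"
  assumes cinner_add_right: "cinner x (y + z) = cinner x y + cinner x z"
    and cinner_scale_right: "cinner x (scale c y) = c * cinner x y"
    and cinner_commute: "cinner x y = cnj (cinner y x)"
    and cinner_nonneg: "0 \<le> Re (cinner x x)"
    and cinner_definite: "cinner x x = 0 \<Longrightarrow> x = 0"
begin

definition hnorm :: "'h \<Rightarrow> real"
  where "hnorm x = sqrt (Re (cinner x x))"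

definition orthonormal_basis :: "nat \<Rightarrow> (nat \<Rightarrow> 'h) \<Rightarrow> bool"
  where "orthonormal_basis d e \<longleftrightarrow>
    (\<forall>i<d. \<forall>j<d. cinner (e i) (e j) = (if i = j then 1 else 0)) \<and>
    module.span scale (e ` {..<d}) = UNIV"

definition is_state :: "'h \<Rightarrow> bool"
  where "is_state \<psi> \<longleftrightarrow> hnorm \<psi> = 1"

definition support_size :: "nat \<Rightarrow> (nat \<Rightarrow> 'h) \<Rightarrow> 'h \<Rightarrow> nat"
  where "support_size d e \<psi> = card {i. i < d \<and> cinner (e i) \<psi> \<noteq> 0}"

definition UNCD :: "nat \<Rightarrow> (nat \<Rightarrow> 'h) \<Rightarrow> (nat \<Rightarrow> 'h) \<Rightarrow> (nat \<times> nat) set"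
  where "UNCD d a b = {(n\<^sub>A, n\<^sub>B). n\<^sub>A \<in> {1..d} \<and> n\<^sub>B \<in> {1..d} \<and>
    (\<exists>\<psi>. is_state \<psi> \<and> support_size d a \<psi> = n\<^sub>A \<and> support_size d b \<psi> = n\<^sub>B)}"

end

locale complex_hilbert_space = complex_inner_product_space scale cinner
  for scale :: "complex \<Rightarrow> 'h::ab_group_add \<Rightarrow> 'h"
    and cinner :: "'h \<Rightarrow> 'h \<Rightarrow> complex" +
  assumes complete:
    "(\<And>e. e > 0 \<Longrightarrow> \<exists>N. \<forall>m\<ge>N. \<forall>n\<ge>N. hnorm (X m - X n) < e) \<Longrightarrow>
      \<exists>x. (\<lambda>n. hnorm (X n - x)) \<longlonglongrightarrow> 0"

end

theory Submission
  imports Defs "HOL-Computational_Algebra.Polynomial"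
begin

text \<open>A state supported on the first \<open>n\<^sub>A\<close> vectors of the basis \<open>a\<close> is a polynomial of degree
  \<open>n\<^sub>A - 1\<close>, and its overlaps with the basis \<open>b\<close> are, up to \<open>1 / \<surd>d\<close>, the values of this polynomial at
  the powers of \<open>q = exp (-2\<pi>\<i>/d)\<close>. The product of \<open>X - q^k\<close> over \<open>k < d - n\<^sub>B\<close> vanishes at exactly
  \<open>d - n\<^sub>B\<close> of these points. Comparing its values at \<open>qX\<close> and \<open>X\<close> gives a two-term recurrence for its
  coefficients (which are \<open>q\<close>-binomial up to powers of \<open>q\<close> and sign), so none of them is \<open>0\<close>.
  Multiplication by linear factors \<open>X - t\<close> with generic \<open>t\<close> raises its degree to \<open>n\<^sub>A - 1\<close> and
  preserves both properties.\<close>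

definition geometric_poly :: "'a::comm_ring_1 \<Rightarrow> nat \<Rightarrow> 'a poly"
  where "geometric_poly q m = (\<Prod>k<m. [:- (q ^ k), 1:])"

lemma degree_geometric_poly [simp]:
  fixes q :: "'a::idom"
  shows "degree (geometric_poly q m) = m"
  unfolding geometric_poly_def by (subst degree_prod_eq_sum_degree) auto

lemma lead_coeff_geometric_poly:
  fixes q :: "'a::idom"
  shows "coeff (geometric_poly q m) m = 1"
proof -
  have "lead_coeff (geometric_poly q m) = 1"
    unfolding geometric_poly_def by (subst lead_coeff_prod) auto
  then show ?thesis by simp
qed

lemma poly_geometric_poly_eq_0_iff:
  fixes q :: "'a::idom"
  shows "poly (geometric_poly q m) x = 0 \<longleftrightarrow> (\<exists>k<m. x = q ^ k)"
  by (auto simp: geometric_poly_def poly_prod)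

text \<open>Substituting \<open>q X\<close> turns \<open>X - q^(k+1)\<close> into
  \<open>q (X - q^k)\<close>, so every factor but the first slides down one place. The factor
  \<open>X - q^m\<close> on the left completes the product again and avoids division.\<close>

lemma geometric_poly_pcompose:
  fixes q :: "'a::idom"
  shows "[:- (q ^ m), 1:] * pcompose (geometric_poly q (Suc m)) [:0, q:] =
    smult (q ^ m) ([:-1, q:] * geometric_poly q (Suc m))"
proof (induction m)
  case 0
  then show ?case by (simp add: geometric_poly_def pcompose_pCons)
next
  case (Suc m)
  let ?P = "\<lambda>m. geometric_poly q m" and ?L = "\<lambda>m. [:- (q ^ m), 1:]"
  have step: "?P (Suc (Suc m)) = ?L (Suc m) * ?P (Suc m)"
    by (simp add: geometric_poly_def mult_ac)
  have lin: "pcompose (?L (Suc m)) [:0, q:] = smult q (?L m)"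
    by (simp add: pcompose_pCons)
  have "?L (Suc m) * pcompose (?P (Suc (Suc m))) [:0, q:] =
      ?L (Suc m) * (smult q (?L m) * pcompose (?P (Suc m)) [:0, q:])"
    by (simp only: step pcompose_mult lin)
  also have "\<dots> = smult q (?L (Suc m) * (?L m * pcompose (?P (Suc m)) [:0, q:]))"
    by (simp only: mult_smult_left mult_smult_right)
  also have "\<dots> = smult q (?L (Suc m) * smult (q ^ m) ([:-1, q:] * ?P (Suc m)))"
    by (simp only: Suc)
  also have "\<dots> = smult (q ^ Suc m) ([:-1, q:] * (?L (Suc m) * ?P (Suc m)))"
    by (simp only: mult_smult_left mult_smult_right smult_smult power_Suc mult.left_commute)
  also have "\<dots> = smult (q ^ Suc m) ([:-1, q:] * ?P (Suc (Suc m)))"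
    by (simp only: step)
  finally show ?case .
qed

text \<open>Compare the coefficients of \<open>X^(k+1)\<close> on both sides of the substitution
  identity.\<close>

lemma coeff_geometric_poly_rec:
  fixes q :: "'a::idom"
  shows "(q ^ k - q ^ Suc m) * coeff (geometric_poly q (Suc m)) k =
    q ^ m * (q ^ Suc k - 1) * coeff (geometric_poly q (Suc m)) (Suc k)"
  using arg_cong[OF geometric_poly_pcompose[of q m], of "\<lambda>p. coeff p (Suc k)"]
  by (simp add: coeff_pcompose_linear algebra_simps)

text \<open>Descend from the leading coefficient 1: for \<open>k < m\<close> the factor in front of
  coefficient \<open>k + 1\<close> in the recurrence is nonzero, so coefficient \<open>k\<close>
  cannot vanish.\<close>

lemma coeff_geometric_poly_nonzero:
  fixes q :: "'a::idom"
  assumes inj: "inj_on (\<lambda>k. q ^ k) {..m}" and q: "q \<noteq> 0" and "k \<le> m"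
  shows "coeff (geometric_poly q m) k \<noteq> 0"
  using \<open>k \<le> m\<close>
proof (induction rule: inc_induct)
  case base
  then show ?case by (simp add: lead_coeff_geometric_poly)
next
  case (step k)
  then obtain m' where m: "m = Suc m'" by (cases m) auto
  have "q ^ Suc k \<noteq> 1"
    using inj_onD[OF inj, of "Suc k" 0] step.hyps by auto
  then show ?case
    using coeff_geometric_poly_rec[of q k m'] step q by (auto simp: m)
qed

lemma exists_poly_degree_nonzero_coeffs_same_roots:
  fixes p :: "'a::{idom,ring_char_0} poly"
  assumes "finite F" and nz: "\<And>k. k \<le> degree p \<Longrightarrow> coeff p k \<noteq> 0" and "degree p \<le> n"
  shows "\<exists>r. degree r = n \<and> (\<forall>k\<le>n. coeff r k \<noteq> 0) \<and> (\<forall>x\<in>F. poly r x = 0 \<longleftrightarrow> poly p x = 0)"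
  using \<open>degree p \<le> n\<close>
proof (induction rule: dec_induct)
  case base
  then show ?case using nz by blast
next
  case (step n)
  then obtain r where r: "degree r = n" "\<And>k. k \<le> n \<Longrightarrow> coeff r k \<noteq> 0"
    "\<And>x. x \<in> F \<Longrightarrow> poly r x = 0 \<longleftrightarrow> poly p x = 0" by blast
  \<comment> \<open>Excluding \<open>F\<close> prevents new roots there, and excluding 0 keeps the
    constant coefficient. The linear polynomial in \<open>t\<close> for \<open>k\<close> is
    coefficient \<open>k + 1\<close> of \<open>(X - t) r\<close>.\<close>
  let ?bad = "insert 0 F \<union> (\<Union>k<n. {t. poly [:coeff r k, - coeff r (Suc k):] t = 0})"
  have "finite ?bad"
    using \<open>finite F\<close> r(2) by (intro finite_UnI finite_insert[THEN iffD2] finite_UN_I poly_roots_finite) auto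
  then obtain t where t: "t \<notin> ?bad"
    using ex_new_if_finite[OF infinite_UNIV_char_0] by blast
  let ?r = "[:- t, 1:] * r"
  have "r \<noteq> 0" using r(2)[of n] by auto
  then have "degree ?r = Suc n" using r(1) by (subst degree_mult_eq) auto
  moreover have "coeff ?r k \<noteq> 0" if "k \<le> Suc n" for k
  proof (cases k)
    case 0
    then show ?thesis using t r(2)[of 0] by auto
  next
    case (Suc l)
    show ?thesis
    proof (cases "l < n")
      case True
      then show ?thesis using t Suc by (auto simp: algebra_simps)
    next
      case False
      then have "l = n" using Suc that by simp
      \<comment> \<open>The leading coefficient of \<open>r\<close> is inherited, since
        \<open>r\<close> has no term of degree \<open>n + 1\<close>.\<close>
      then show ?thesis using Suc r(2)[of n] r(1) by (simp add: coeff_eq_0)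
    qed
  qed
  moreover have "poly ?r x = 0 \<longleftrightarrow> poly p x = 0" if "x \<in> F" for x
    using that t r(3)[OF that] by auto
  ultimately show ?case by blast
qed

text \<open>Undoing the conjugation reduces this to the distinctness of the \<open>d\<close>-th
  roots of unity.\<close>

lemma inj_on_power_root_of_unity:
  assumes "d > 0"
  shows "inj_on (\<lambda>k. cnj (exp (2 * complex_of_real pi * \<i> / of_nat d)) ^ k) {..<d}"
proof (rule inj_onI)
  fix j k assume jk: "j \<in> {..<d}" "k \<in> {..<d}"
    and eq: "cnj (exp (2 * complex_of_real pi * \<i> / of_nat d)) ^ j =
      cnj (exp (2 * complex_of_real pi * \<i> / of_nat d)) ^ k"
  have "exp (2 * complex_of_real pi * \<i> / of_nat d) ^ l = cis (2 * pi * real l / real d)" for l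
    by (simp add: cis_conv_exp flip: exp_of_nat_mult) (simp add: field_simps)
  then have "cis (2 * pi * real j / real d) = cis (2 * pi * real k / real d)"
    using eq by (metis complex_cnj_cancel_iff complex_cnj_power)
  then show "j = k"
    using inj_onD[OF bij_betw_imp_inj_on[OF bij_betw_roots_unity[OF assms]]] jk by blast
qed

context complex_inner_product_space
begin

lemma cinner_zero_right [simp]: "cinner x 0 = 0"
  using cinner_add_right[of x 0 0] by simp

lemma cinner_sum_right: "cinner x (sum f I) = (\<Sum>i\<in>I. cinner x (f i))"
  by (induction I rule: infinite_finite_induct) (simp_all add: cinner_add_right)

lemma cinner_scale_left: "cinner (scale c x) y = cnj c * cinner x y"
  by (metis cinner_commute cinner_scale_right complex_cnj_mult)

lemma Im_cinner_self: "Im (cinner x x) = 0"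
  using arg_cong[OF cinner_commute[of x x], of Im] by simp

lemma hnorm_scale: "hnorm (scale c x) = cmod c * hnorm x"
proof -
  have "cinner (scale c x) (scale c x) = complex_of_real ((cmod c)\<^sup>2) * cinner x x"
    by (simp add: cinner_scale_left cinner_scale_right complex_norm_square mult_ac del: of_real_power)
  then show ?thesis
    by (simp add: hnorm_def real_sqrt_mult Im_cinner_self)
qed

lemma hnorm_eq_0_iff: "hnorm x = 0 \<longleftrightarrow> x = 0"
  by (metis Im_cinner_self cinner_definite cinner_zero_right complex_eq_iff hnorm_def
      real_sqrt_eq_zero_cancel_iff zero_complex.sel)

lemma support_size_scale: "c \<noteq> 0 \<Longrightarrow> support_size d e (scale c x) = support_size d e x"
  by (simp add: support_size_def cinner_scale_right)

text \<open>Normalising a nonzero vector leaves both supports unchanged.\<close>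

lemma UNCD_I:
  assumes "\<psi> \<noteq> 0" "support_size d a \<psi> = m" "support_size d b \<psi> = n" "m \<in> {1..d}" "n \<in> {1..d}"
  shows "(m, n) \<in> UNCD d a b"
proof -
  let ?\<phi> = "scale (complex_of_real (inverse (hnorm \<psi>))) \<psi>"
  have "hnorm \<psi> \<noteq> 0" using assms by (simp add: hnorm_eq_0_iff)
  moreover have "hnorm \<psi> \<ge> 0" by (simp add: hnorm_def cinner_nonneg)
  ultimately have "is_state ?\<phi>" "support_size d a ?\<phi> = m" "support_size d b ?\<phi> = n"
    using assms by (simp_all add: is_state_def hnorm_scale support_size_scale norm_inverse)
  then show ?thesis using assms unfolding UNCD_def by blast
qed

end

theorem corollary1:
  fixes scale :: "complex \<Rightarrow> 'h::ab_group_add \<Rightarrow> 'h"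
    and cinner :: "'h \<Rightarrow> 'h \<Rightarrow> complex"
    and a b :: "nat \<Rightarrow> 'h"
    and d n\<^sub>A n\<^sub>B :: nat
  assumes hilbert: "complex_hilbert_space scale cinner"
    and d: "d \<ge> 1"
    and dim: "vector_space.dim scale (UNIV :: 'h set) = d"
    and basis_a: "complex_inner_product_space.orthonormal_basis scale cinner d a"
    and basis_b: "complex_inner_product_space.orthonormal_basis scale cinner d b"
    and dft: "\<And>i j. i < d \<Longrightarrow> j < d \<Longrightarrow>
      cinner (a i) (b j) =
        1 / complex_of_real (sqrt (real d)) * exp (2 * complex_of_real pi * \<i> / of_nat d) ^ (i * j)"
    and n\<^sub>A: "n\<^sub>A \<in> {1..d}"
    and n\<^sub>B: "n\<^sub>B \<in> {1..d}"
    and sum: "n\<^sub>A + n\<^sub>B \<ge> d + 1"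
  shows "(n\<^sub>A, n\<^sub>B) \<in> complex_inner_product_space.UNCD cinner d a b"
proof -
  interpret complex_hilbert_space scale cinner by (rule hilbert)
  \<comment> \<open>The conjugate enters because \<open>cinner (b j) (a i)\<close> is the conjugate
    of the given DFT entry.\<close>
  define q where "q = cnj (exp (2 * complex_of_real pi * \<i> / of_nat d))"
  \<comment> \<open>The number of overlaps with \<open>b\<close> that must vanish. The hypothesis on
    the sum says exactly that degree \<open>n\<^sub>A - 1\<close> leaves room for \<open>m\<close>
    roots.\<close>
  define m where "m = d - n\<^sub>B"
  have m: "m < d" "m \<le> n\<^sub>A - 1" using d n\<^sub>A n\<^sub>B sum by (auto simp: m_def)
  have inj: "inj_on (\<lambda>k. q ^ k) {..<d}"
    unfolding q_def using d by (intro inj_on_power_root_of_unity) auto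
  have nz: "coeff (geometric_poly q m) k \<noteq> 0" if "k \<le> m" for k
    using m that by (intro coeff_geometric_poly_nonzero inj_on_subset[OF inj]) (auto simp: q_def)
  obtain p where p: "degree p = n\<^sub>A - 1" "\<And>k. k \<le> n\<^sub>A - 1 \<Longrightarrow> coeff p k \<noteq> 0"
    and roots: "\<And>j. j < d \<Longrightarrow> poly p (q ^ j) = 0 \<longleftrightarrow> poly (geometric_poly q m) (q ^ j) = 0"
    using exists_poly_degree_nonzero_coeffs_same_roots
      [of "(\<lambda>k. q ^ k) ` {..<d}" "geometric_poly q m" "n\<^sub>A - 1"] nz m by auto
  \<comment> \<open>Degree \<open>n\<^sub>A - 1\<close> with no zero coefficient gives exactly
    \<open>n\<^sub>A\<close> nonzero coordinates in \<open>a\<close>.\<close>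
  define \<psi> where "\<psi> = (\<Sum>i<n\<^sub>A. scale (coeff p i) (a i))"
  have A: "cinner (a i) \<psi> = (if i < n\<^sub>A then coeff p i else 0)" if "i < d" for i
  proof -
    have "cinner (a i) \<psi> = (\<Sum>k<n\<^sub>A. if i = k then coeff p k else 0)"
      unfolding \<psi>_def cinner_sum_right
      using basis_a n\<^sub>A that by (intro sum.cong) (auto simp: cinner_scale_right orthonormal_basis_def)
    then show ?thesis by simp
  qed
  have B: "cinner (b j) \<psi> = poly p (q ^ j) / complex_of_real (sqrt (real d))" if "j < d" for j
  proof -
    have "cinner (b j) (a i) = (q ^ j) ^ i / complex_of_real (sqrt (real d))" if "i < n\<^sub>A" for i
    proof -
      have "cinner (b j) (a i) = cnj (cinner (a i) (b j))" by (rule cinner_commute)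
      then show ?thesis
        using dft[of i j] \<open>j < d\<close> that n\<^sub>A by (simp add: q_def mult.commute flip: power_mult)
    qed
    then have "cinner (b j) \<psi> = (\<Sum>i<n\<^sub>A. coeff p i * (q ^ j) ^ i) / complex_of_real (sqrt (real d))"
      by (simp add: \<psi>_def cinner_sum_right cinner_scale_right sum_divide_distrib)
    moreover have "{..degree p} = {..<n\<^sub>A}" using p(1) n\<^sub>A by auto
    ultimately show ?thesis by (simp add: poly_altdef)
  qed
  have "{i. i < d \<and> cinner (a i) \<psi> \<noteq> 0} = {..<n\<^sub>A}"
    using A p(2) n\<^sub>A by (auto split: if_splits)
  then have "support_size d a \<psi> = n\<^sub>A" by (simp add: support_size_def)
  moreover have "cinner (b j) \<psi> = 0 \<longleftrightarrow> j < m" if "j < d" for j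
  proof -
    have "cinner (b j) \<psi> = 0 \<longleftrightarrow> (\<exists>k<m. q ^ j = q ^ k)"
      using B[OF that] roots[OF that] d by (simp add: poly_geometric_poly_eq_0_iff)
    \<comment> \<open>Distinctness of the powers of \<open>q\<close> excludes further zeros among
      the overlaps.\<close>
    also have "\<dots> \<longleftrightarrow> j < m" using inj_onD[OF inj, of j] that m by auto
    finally show ?thesis .
  qed
  then have "{j. j < d \<and> cinner (b j) \<psi> \<noteq> 0} = {m..<d}" by auto
  then have "support_size d b \<psi> = n\<^sub>B" using n\<^sub>B by (simp add: support_size_def m_def)
  moreover have "\<psi> \<noteq> 0" using A[of 0] p(2)[of 0] d n\<^sub>A by auto
  ultimately show ?thesis using n\<^sub>A n\<^sub>B by (intro UNCD_I) auto
qed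

end
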